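(* Let $q$ be a complex number with $0<|q|<1$. Define sequences $(P_m)_{m\ge -1}$ and $(Q_m)_{m\ge -1}$ by $$P_m=(1+q^{2m-1})P_{m-1}+q^{2m-2}P_{m-2}\quad(m\ge 2),\qquad P_{-1}=0,\ P_0=1,\ P_1=1+q,$$ $$Q_m=(1+q^{2m-1})Q_{m-1}+q^{2m-2}Q_{m-2}\quad(m\ge 2),\qquad Q_{-1}=1,\ Q_0=0,\ Q_1=1.$$ Then for every integer $m\ge 0$, $$\sum_{n=0}^{\infty}\frac{(-q;q^2)_nq^{n^2+2mn}}{(q^2;q^2)_n}=\frac{(-1)^mq^{m-m^2}Q_{m-1}}{(q,q^4,q^7;q^8)_{\infty}}-\frac{(-1)^mq^{m-m^2}P_{m-1}}{(q^3,q^4,q^5;q^8)_{\infty}}.$$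
   Context: For $|p|<1$, $(a;p)_\infty=\prod_{k=0}^{\infty}(1-ap^k)$ and, for an integer $n\ge 0$, $(a;p)_n=\prod_{k=0}^{n-1}(1-ap^k)$. Multiple $q$-shifted factorials are products: $(a_1,\dots,a_r;p)_\infty=(a_1;p)_\infty\cdots(a_r;p)_\infty$. *)

theory Defs
  imports "HOL-Analysis.Analysis"
begin

definition qshift :: "complex \<Rightarrow> complex \<Rightarrow> nat \<Rightarrow> complex" where
  "qshift a p n = (\<Prod>k<n. 1 - a * p ^ k)"

text \<open>Only meaningful for \<open>norm p < 1\<close>, where the infinite product converges; as with
  the library's notion of a convergent product, finitely many factors may vanish.\<close>

definition qshift_inf :: "complex \<Rightarrow> complex \<Rightarrow> complex" where
  "qshift_inf a p = (\<Prod>k. 1 - a * p ^ k)"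

definition qshifts_inf :: "complex list \<Rightarrow> complex \<Rightarrow> complex" where
  "qshifts_inf as p = (\<Prod>a\<leftarrow>as. qshift_inf a p)"

end

theory Submission
  imports Defs
begin

text \<open>
  Let \<open>S m\<close> be the series on the left-hand side. It satisfies
  $S_m = (1 + q^{2m+1}) S_{m+1} + q^{2m+2} S_{m+2}$, and the recurrences of \<open>P\<close> and \<open>Q\<close> say that the
  right-hand side satisfies the same recurrence, so it suffices to evaluate $S_0$ and $S_1$: these are
  the Goellnitz--Gordon identities. Since $S_m \to 1$ and the coefficients of the recurrence are
  summable perturbations of $1, 0$, the sequence \<open>S\<close> is the only solution with this limit. A second
  solution with limit 1 is given by a very-well-poised series, for which the recurrence is certified by
  telescoping; at \<open>m = 0\<close> and \<open>m = 1\<close> this series is a product times a theta series, which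
  the Jacobi triple product (obtained as a limit of the finite \<open>q\<close>-binomial theorem) evaluates.
\<close>

section \<open>Shifted factorials and the triple product\<close>

lemma qshift_0 [simp]: "qshift a p 0 = 1"
  by (simp add: qshift_def)

lemma qshift_Suc [simp]: "qshift a p (Suc n) = qshift a p n * (1 - a * p ^ n)"
  by (simp add: qshift_def)

lemma qshift_add: "qshift a p (m + n) = qshift a p m * qshift (a * p ^ m) p n"
  by (induction n) (simp_all add: power_add mult_ac)

lemma norm_mult_power_less_1:
  fixes a p :: complex
  assumes "norm a < 1" "norm p < 1"
  shows "norm (a * p ^ n) < 1"
proof -
  have "norm (a * p ^ n) \<le> norm a * 1"
    unfolding norm_mult norm_power using assms by (intro mult_left_mono power_le_one) auto
  thus ?thesis using assms by simp
qed

lemma one_minus_nonzero: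
  fixes a :: complex
  shows "norm a < 1 \<Longrightarrow> 1 - a \<noteq> 0"
  by auto

lemma qshift_nonzero:
  assumes "norm a < 1" "norm p < 1"
  shows "qshift a p n \<noteq> 0"
  using one_minus_nonzero[OF norm_mult_power_less_1[OF assms]] by (simp add: qshift_def)

lemma convergent_prod_qshift:
  fixes a p :: complex
  assumes "norm p < 1"
  shows "convergent_prod (\<lambda>k. 1 - a * p ^ k)"
proof (intro abs_convergent_prod_imp_convergent_prod summable_imp_abs_convergent_prod)
  have "summable (\<lambda>k. norm a * norm p ^ k)"
    using assms by (intro summable_mult summable_geometric) auto
  thus "summable (\<lambda>k. norm (1 - a * p ^ k - 1))"
    by (simp add: norm_mult norm_power)
qed

lemma qshift_tendsto:
  assumes "norm p < 1"
  shows "qshift a p \<longlonglongrightarrow> qshift_inf a p"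
  unfolding qshift_def qshift_inf_def LIMSEQ_lessThan_iff_atMost
  by (rule convergent_prod_LIMSEQ[OF convergent_prod_qshift[OF assms]])

lemma qshift_inf_nonzero:
  assumes "norm a < 1" "norm p < 1"
  shows "qshift_inf a p \<noteq> 0"
  unfolding qshift_inf_def
  using convergent_prod_qshift[OF assms(2)] one_minus_nonzero[OF norm_mult_power_less_1[OF assms]]
  by (rule prodinf_nonzero)

lemma qshift_inf_split:
  assumes "norm p < 1"
  shows "qshift_inf a p = qshift a p n * qshift_inf (a * p ^ n) p"
proof (rule LIMSEQ_unique)
  show "(\<lambda>k. qshift a p (n + k)) \<longlonglongrightarrow> qshift_inf a p"
    using LIMSEQ_ignore_initial_segment[OF qshift_tendsto[OF assms], of a n]
    by (simp add: add.commute)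
  show "(\<lambda>k. qshift a p (n + k)) \<longlonglongrightarrow> qshift a p n * qshift_inf (a * p ^ n) p"
    unfolding qshift_add by (intro tendsto_intros qshift_tendsto assms)
qed

lemma qshift_inf_rec:
  assumes "norm p < 1"
  shows "qshift_inf a p = (1 - a) * qshift_inf (a * p) p"
  using qshift_inf_split[OF assms, of a 1] by simp

text \<open>The tail is the infinite product divided by its \<open>n\<close>-th partial product; the
  quotient tends to 1 because the infinite product is nonzero.\<close>

lemma qshift_inf_power_tendsto:
  assumes "norm a < 1" "norm p < 1"
  shows "(\<lambda>n. qshift_inf (a * p ^ n) p) \<longlonglongrightarrow> 1"
proof -
  have "(\<lambda>n. qshift_inf a p / qshift a p n) \<longlonglongrightarrow> qshift_inf a p / qshift_inf a p"
    using assms by (intro tendsto_intros qshift_tendsto qshift_inf_nonzero)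
  moreover have "qshift_inf a p / qshift a p n = qshift_inf (a * p ^ n) p" for n
    using qshift_inf_split[OF assms(2), of a n] qshift_nonzero[OF assms, of n] by simp
  ultimately show ?thesis
    using qshift_inf_nonzero[OF assms] by simp
qed

lemma bounded_if_tendsto:
  fixes f :: "nat \<Rightarrow> 'a :: real_normed_vector"
  assumes "f \<longlonglongrightarrow> l"
  shows "\<exists>B>0. \<forall>n. norm (f n) \<le> B"
  using convergent_imp_Bseq[OF convergentI[OF assms]] by (auto elim: BseqE)

text \<open>In partial products of even length, the factors are sorted by the parity of the
  exponent.\<close>

lemma qshift_inf_dissect:
  assumes "norm p < 1"
  shows "qshift_inf a p = qshift_inf a (p ^ 2) * qshift_inf (a * p) (p ^ 2)"
proof (rule LIMSEQ_unique)
  have p2: "norm (p ^ 2) < 1"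
    using assms by (simp add: norm_power power_less_one_iff)
  have eq: "qshift a p (2 * n) = qshift a (p ^ 2) n * qshift (a * p) (p ^ 2) n" for n
    by (induction n) (simp_all add: mult_ac flip: power_mult)
  show "(\<lambda>n. qshift a p (2 * n)) \<longlonglongrightarrow> qshift_inf a (p ^ 2) * qshift_inf (a * p) (p ^ 2)"
    unfolding eq by (intro tendsto_intros qshift_tendsto p2)
  show "(\<lambda>n. qshift a p (2 * n)) \<longlonglongrightarrow> qshift_inf a p"
    by (rule filterlim_compose[OF qshift_tendsto[OF assms]])
       (auto intro!: filterlim_subseq simp: strict_mono_def)
qed

lemma qshift_inf_square:
  assumes "norm p < 1"
  shows "qshift_inf (a ^ 2) (p ^ 2) = qshift_inf a p * qshift_inf (- a) p"
proof (rule LIMSEQ_unique)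
  have p2: "norm (p ^ 2) < 1"
    using assms by (simp add: norm_power power_less_one_iff)
  have eq: "qshift (a ^ 2) (p ^ 2) n = qshift a p n * qshift (- a) p n" for n
    by (induction n) (simp_all add: power2_eq_square algebra_simps flip: power_mult_distrib)
  show "qshift (a ^ 2) (p ^ 2) \<longlonglongrightarrow> qshift_inf (a ^ 2) (p ^ 2)"
    by (rule qshift_tendsto[OF p2])
  show "qshift (a ^ 2) (p ^ 2) \<longlonglongrightarrow> qshift_inf a p * qshift_inf (- a) p"
    unfolding eq by (intro tendsto_intros qshift_tendsto assms)
qed

section \<open>Gaussian binomial coefficients and the finite q-binomial theorem\<close>

definition qbinom :: "complex \<Rightarrow> nat \<Rightarrow> nat \<Rightarrow> complex" where
  "qbinom p M k = (if k \<le> M then qshift p p M / (qshift p p k * qshift p p (M - k)) else 0)"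

text \<open>One of the two q-analogues of Pascal's rule, obtained over a common denominator. In the
  boundary case \<open>k = M\<close> the first summand is the default value 0 of
  \<open>qbinom\<close>, which the quotient with a truncated difference would not give.\<close>

lemma qbinom_Suc_Suc:
  assumes p: "norm p < 1" and k: "k \<le> M"
  shows "qbinom p (Suc M) (Suc k) = qbinom p M (Suc k) + p ^ (M - k) * qbinom p M k"
proof (cases "k = M")
  case True
  thus ?thesis using p qshift_nonzero[OF p p, of M] qshift_nonzero[OF p p, of "Suc M"]
    by (simp add: qbinom_def del: qshift_Suc)
next
  case False
  define d where "d = M - k - 1"
  have M: "M = Suc (k + d)" using k False by (simp add: d_def)
  note nz = qshift_nonzero[OF p p] 
  have nz1: "1 - p * p ^ n \<noteq> 0" for n
    using one_minus_nonzero[OF norm_mult_power_less_1[OF p p]] .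
  show ?thesis unfolding M using nz nz1[of k] nz1[of d]
    by (simp add: qbinom_def divide_simps) (simp add: algebra_simps power_add)
qed

text \<open>Induction on \<open>M\<close>: multiplication by the new factor
  \<open>y - x * p ^ M\<close> matches Pascal's rule. The form homogeneous in \<open>x\<close> and
  \<open>y\<close> allows \<open>y\<close> to become a power of \<open>p\<close>, which the triple
  product needs to centre the product.\<close>

lemma qbinomial_theorem:
  assumes p: "norm p < 1"
  shows "(\<Prod>k<M. y - x * p ^ k)
    = (\<Sum>k\<le>M. qbinom p M k * (- 1) ^ k * p ^ (k choose 2) * x ^ k * y ^ (M - k))"
proof (induction M)
  case 0
  show ?case by (simp add: qbinom_def numeral_2_eq_2)
next
  case (Suc M)
  define t where "t M k = qbinom p M k * (- 1) ^ k * p ^ (k choose 2) * x ^ k * y ^ (M - k)" for M k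
  have t0: "t (Suc M) 0 = y * t M 0"
    using qshift_nonzero[OF p p, of M] qshift_nonzero[OF p p, of "Suc M"]
    by (simp add: t_def qbinom_def del: qshift_Suc)
  have step: "t (Suc M) (Suc k) = y * t M (Suc k) - x * p ^ M * t M k" if k: "k \<le> M" for k
  proof -
    have e: "Suc k choose 2 = (k choose 2) + k"
      by (simp add: numeral_2_eq_2)
    \<comment> \<open>At \<open>k = M\<close> the exponent \<open>M - Suc k\<close> is truncated,
      but then the coefficient vanishes.\<close>
    have a: "qbinom p M (Suc k) * y ^ (M - k) = qbinom p M (Suc k) * (y * y ^ (M - Suc k))"
      using k by (cases "k = M") (simp_all add: qbinom_def Suc_diff_Suc flip: power_Suc)
    have b: "p ^ M = p ^ (M - k) * p ^ k"
      using k by (simp flip: power_add)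
    have "t (Suc M) (Suc k) = (- 1) ^ Suc k * p ^ (k choose 2) * p ^ k * x ^ Suc k
        * (qbinom p M (Suc k) * y ^ (M - k) + p ^ (M - k) * qbinom p M k * y ^ (M - k))"
      by (simp add: t_def qbinom_Suc_Suc[OF p k] e power_add algebra_simps)
    also have "\<dots> = y * t M (Suc k) - x * p ^ M * t M k"
      unfolding a b by (simp add: t_def e power_add algebra_simps)
    finally show ?thesis .
  qed
  have "(\<Sum>k\<le>Suc M. t (Suc M) k) = y * (t M 0 + (\<Sum>k\<le>M. t M (Suc k))) - x * p ^ M * (\<Sum>k\<le>M. t M k)"
    unfolding sum.atMost_Suc_shift t0
    by (simp add: step sum_subtractf sum_distrib_left distrib_left)
  also have "t M 0 + (\<Sum>k\<le>M. t M (Suc k)) = (\<Sum>k\<le>Suc M. t M k)"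
    by (rule sum.atMost_Suc_shift[symmetric])
  also have "\<dots> = (\<Sum>k\<le>M. t M k)"
    by (simp add: t_def qbinom_def)
  finally have "(\<Sum>k\<le>Suc M. t (Suc M) k) = (y - x * p ^ M) * (\<Sum>k\<le>M. t M k)"
    by (simp add: algebra_simps)
  thus ?case using Suc.IH by (simp add: t_def)
qed

section \<open>The Jacobi triple product\<close>

lemma prod_lessThan_add:
  fixes f :: "nat \<Rightarrow> 'a :: comm_monoid_mult"
  shows "prod f {..<m + n} = prod f {..<m} * (\<Prod>k<n. f (m + k))"
  by (induction n) (simp_all add: mult_ac)

text \<open>Pairs the indices symmetric about N + 1/2. In the triple product they belong to the
  exponents -n and n + 1 of the bilateral theta series.\<close>

lemma sum_atMost_fold:
  fixes f :: "nat \<Rightarrow> 'a :: comm_monoid_add"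
  shows "(\<Sum>k\<le>2 * N + 1. f k) = (\<Sum>n\<le>N. f (N - n) + f (N + 1 + n))"
proof -
  have "(\<Sum>k\<le>N + Suc n. f k) = (\<Sum>k\<le>N. f k) + (\<Sum>k\<le>n. f (N + 1 + k))" for n
    by (induction n) (simp_all add: add_ac)
  from this[of N] have "(\<Sum>k\<le>2 * N + 1. f k) = (\<Sum>k\<le>N. f k) + (\<Sum>k\<le>N. f (N + 1 + k))"
    by (simp add: mult_2)
  also have "(\<Sum>k\<le>N. f k) = (\<Sum>k\<le>N. f (N - k))"
    using sum.nat_diff_reindex[of f "Suc N"] by (simp add: lessThan_Suc_atMost)
  finally show ?thesis by (simp add: sum.distrib)
qed

text \<open>A division-free form of k(k-1)/2, so that equations between triangular exponents become
  polynomial ones.\<close>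

lemma choose_two_square: "2 * (k choose 2) + k = k * k" for k :: nat
  by (induction k) (auto simp: numeral_2_eq_2)

lemma Suc_choose_two: "Suc k choose 2 = (k choose 2) + k"
  by (simp add: numeral_2_eq_2)

text \<open>The q-binomial theorem with \<open>M = 2 * N + 1\<close>, \<open>x = a\<close> and
  \<open>y = p ^ N\<close>: the first \<open>N\<close> factors give the product in
  \<open>p / a\<close>, the other \<open>N + 1\<close> the product in \<open>a\<close>, and the
  monomials left over combine to \<open>c\<close>. Folding the sum joins the exponents -n and n + 1
  of \<open>a\<close>, so the theta series is indexed by natural numbers.\<close>

lemma finite_triple_product:
  assumes p: "norm p < 1" "p \<noteq> 0" and a: "a \<noteq> 0"
  shows "qshift (p / a) p N * qshift a p (Suc N)
    = (\<Sum>n\<le>N. qbinom p (2 * N + 1) (N - n) * ((- 1) ^ n * p ^ (Suc n choose 2) * (1 / a ^ n - a ^ Suc n)))"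
proof -
  define e where "e = (N choose 2) + N * (N + 1)"
  define c where "c = (- a) ^ N * p ^ e"
  define f where "f k = qbinom p (2 * N + 1) k * (- 1) ^ k * p ^ (k choose 2) * a ^ k
    * (p ^ N) ^ (2 * N + 1 - k)" for k
  \<comment> \<open>Each factor equals - a p^k (1 - (p/a) p^(N-1-k)), so the factors of the shifted
    factorial appear in reverse order.\<close>
  have 1: "(\<Prod>k<N. p ^ N - a * p ^ k) = (- a) ^ N * p ^ (N choose 2) * qshift (p / a) p N"
  proof (induction N)
    case 0
    show ?case by (simp add: numeral_2_eq_2)
  next
    case (Suc N)
    have "(\<Prod>k<N. p ^ Suc N - a * p ^ Suc k) = (\<Prod>k<N. p * (p ^ N - a * p ^ k))"
      by (simp add: algebra_simps)
    also have "\<dots> = p ^ N * (\<Prod>k<N. p ^ N - a * p ^ k)"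
      by (simp add: prod.distrib)
    finally show ?case
      unfolding prod.lessThan_Suc_shift Suc.IH using a
      by (simp add: Suc_choose_two power_add field_simps)
  qed
  have 2: "(\<Prod>k<N + 1. p ^ N - a * p ^ (N + k)) = p ^ (N * (N + 1)) * qshift a p (N + 1)"
  proof -
    have "(\<Prod>k<N + 1. p ^ N - a * p ^ (N + k)) = (\<Prod>k<N + 1. p ^ N * (1 - a * p ^ k))"
      by (simp add: power_add algebra_simps)
    thus ?thesis unfolding prod.distrib qshift_def by (simp add: power_mult power_add)
  qed
  have "2 * N + 1 = N + (N + 1)" by simp
  hence "(\<Prod>k<2 * N + 1. p ^ N - a * p ^ k) = (\<Prod>k<N + (N + 1). p ^ N - a * p ^ k)"
    by (simp only:)
  also have "\<dots> = c * (qshift (p / a) p N * qshift a p (Suc N))"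
    by (subst prod_lessThan_add, subst 1, subst 2) (simp only: c_def e_def power_add mult_ac Suc_eq_plus1)
  finally have "c * (qshift (p / a) p N * qshift a p (Suc N)) = (\<Prod>k<2 * N + 1. p ^ N - a * p ^ k)" ..
  also have "\<dots> = (\<Sum>k\<le>2 * N + 1. f k)"
    unfolding qbinomial_theorem[OF p(1)] f_def ..
  also have "\<dots> = (\<Sum>n\<le>N. f (N - n) + f (N + 1 + n))"
    by (rule sum_atMost_fold)
  also have "\<dots> = (\<Sum>n\<le>N. c * (qbinom p (2 * N + 1) (N - n) * ((- 1) ^ n * p ^ (Suc n choose 2) * (1 / a ^ n - a ^ Suc n))))"
  proof (rule sum.cong[OF refl])
    fix n assume "n \<in> {..N}"
    then obtain d where N: "N = n + d" by (auto simp: le_iff_add)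
    \<comment> \<open>Doubling the binomials by \<open>choose_two_square\<close> makes both exponent
      equations polynomial in \<open>n\<close> and \<open>d\<close>. Hence the two paired terms
      carry the same power of \<open>p\<close>.\<close>
    have "(N + 1 + n choose 2) + N * (2 * N + 1 - (N + 1 + n)) = e + (Suc n choose 2)"
      using choose_two_square[of "N + 1 + n"] choose_two_square[of N] choose_two_square[of "Suc n"]
      unfolding e_def N by (simp add: algebra_simps)
    hence e1: "p ^ (N + 1 + n choose 2) * (p ^ N) ^ (2 * N + 1 - (N + 1 + n)) = p ^ e * p ^ (Suc n choose 2)"
      by (simp only: flip: power_mult power_add)
    have "(N - n choose 2) + N * (2 * N + 1 - (N - n)) = e + (Suc n choose 2)"
      using choose_two_square[of "N - n"] choose_two_square[of N] choose_two_square[of "Suc n"]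
      unfolding e_def N by (simp add: algebra_simps)
    hence e2: "p ^ (N - n choose 2) * (p ^ N) ^ (2 * N + 1 - (N - n)) = p ^ e * p ^ (Suc n choose 2)"
      by (simp only: flip: power_mult power_add)
    \<comment> \<open>Symmetry of the Gaussian coefficients under exchanging \<open>k\<close> and
      \<open>M - k\<close>.\<close>
    have b: "qbinom p (2 * N + 1) (N + 1 + n) = qbinom p (2 * N + 1) (N - n)"
    proof -
      have "2 * N + 1 - (N + 1 + n) = N - n" "2 * N + 1 - (N - n) = N + 1 + n"
        by (simp_all add: N)
      thus ?thesis unfolding qbinom_def by (simp add: N mult_ac add_ac mult_2 mult_2_right del: qshift_Suc)
    qed
    have "f (N - n) + f (N + 1 + n) = qbinom p (2 * N + 1) (N - n) *
      ((- 1) ^ (N - n) * a ^ (N - n) * (p ^ (N - n choose 2) * (p ^ N) ^ (2 * N + 1 - (N - n)))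
        + (- 1) ^ (N + 1 + n) * a ^ (N + 1 + n) * (p ^ (N + 1 + n choose 2) * (p ^ N) ^ (2 * N + 1 - (N + 1 + n))))"
      unfolding f_def b by (simp only: distrib_left mult_ac)
    also have "\<dots> = qbinom p (2 * N + 1) (N - n) * (p ^ e * p ^ (Suc n choose 2) *
      ((- 1) ^ (N - n) * a ^ (N - n) + (- 1) ^ (N + 1 + n) * a ^ (N + 1 + n)))"
      unfolding e1 e2 by (simp only: distrib_left mult_ac)
    also have "(- 1) ^ (N - n) * a ^ (N - n) + (- 1) ^ (N + 1 + n) * a ^ (N + 1 + n)
      = (- a) ^ N * ((- 1) ^ n * (1 / a ^ n - a ^ Suc n))"
    proof -
      have "(- 1) ^ (N - n) * a ^ (N - n) + (- 1) ^ (N + 1 + n) * a ^ (N + 1 + n)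
        = (- 1) ^ d * a ^ d * (1 - a ^ n * a ^ Suc n)"
      proof -
        have "N - n = d" "N + 1 + n = d + 2 * n + 1" by (simp_all add: N)
        moreover from this have "(- 1) ^ (N + 1 + n) * a ^ (N + 1 + n) = - ((- 1) ^ d * a ^ d * (a ^ n * a ^ Suc n))"
          by (simp add: power_add power_mult mult_2)
        ultimately show ?thesis by (simp only: distrib_left mult_1_right mult_minus_right diff_conv_add_uminus)
      qed
      also have "\<dots> = ((- 1) ^ d * a ^ n * a ^ d) * (1 / a ^ n - a ^ Suc n)"
        using a by (simp add: field_simps)
      also have "(- 1) ^ d * a ^ n * a ^ d = (- a) ^ N * (- 1) ^ n"
        unfolding N power_minus[of a] by (simp add: power_add)
      finally show ?thesis by (simp only: mult.assoc)
    qed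
    finally show "f (N - n) + f (N + 1 + n) = c * (qbinom p (2 * N + 1) (N - n) * ((- 1) ^ n * p ^ (Suc n choose 2) * (1 / a ^ n - a ^ Suc n)))"
      unfolding c_def by (simp only: mult_ac)
  qed
  also have "\<dots> = c * (\<Sum>n\<le>N. qbinom p (2 * N + 1) (N - n) * ((- 1) ^ n * p ^ (Suc n choose 2) * (1 / a ^ n - a ^ Suc n)))"
    by (simp add: sum_distrib_left)
  finally show ?thesis using p a by (simp add: c_def del: qshift_Suc)
qed

text \<open>Splitting \<open>p ^ (Suc n choose 2)\<close> into
  \<open>p ^ (n choose 2) * p ^ n\<close> leaves a spare \<open>p ^ n\<close> that turns 1 / a^n
  into a power of p / a. The bound is summable once |p| < |a|.\<close>

lemma theta_term_bound:
  fixes a p :: complex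
  assumes p: "norm p < 1" and a: "a \<noteq> 0" "norm a < 1"
  shows "norm ((- 1) ^ n * p ^ (Suc n choose 2) * (1 / a ^ n - a ^ Suc n)) \<le> norm (p / a) ^ n + norm p ^ n"
proof -
  have "norm (p ^ (Suc n choose 2) / a ^ n) = norm p ^ (n choose 2) * norm (p / a) ^ n"
    by (simp add: norm_divide norm_power norm_mult Suc_choose_two power_add power_divide)
  also have "\<dots> \<le> 1 * norm (p / a) ^ n"
    using p by (intro mult_right_mono power_le_one) auto
  finally have 1: "norm (p ^ (Suc n choose 2) / a ^ n) \<le> norm (p / a) ^ n" by simp
  have "norm (p ^ (Suc n choose 2) * a ^ Suc n) = norm p ^ (Suc n choose 2) * norm a ^ Suc n"
    by (simp add: norm_mult norm_power)
  also have "\<dots> \<le> norm p ^ n * 1"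
    using p a by (intro mult_mono power_decreasing power_le_one) (auto simp: Suc_choose_two)
  finally have 2: "norm (p ^ (Suc n choose 2) * a ^ Suc n) \<le> norm p ^ n" by simp
  have "(- 1) ^ n * p ^ (Suc n choose 2) * (1 / a ^ n - a ^ Suc n)
    = (- 1) ^ n * (p ^ (Suc n choose 2) / a ^ n - p ^ (Suc n choose 2) * a ^ Suc n)"
    by (simp add: algebra_simps)
  hence "norm ((- 1) ^ n * p ^ (Suc n choose 2) * (1 / a ^ n - a ^ Suc n))
    = norm (p ^ (Suc n choose 2) / a ^ n - p ^ (Suc n choose 2) * a ^ Suc n)"
    by (simp only: norm_mult norm_power) simp
  also have "\<dots> \<le> norm (p / a) ^ n + norm p ^ n"
    using norm_triangle_ineq4[of "p ^ (Suc n choose 2) / a ^ n" "p ^ (Suc n choose 2) * a ^ Suc n"] 1 2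
    by linarith
  finally show ?thesis .
qed

text \<open>Tannery's theorem for a majorant valid at all indices. The first index of
  \<open>a\<close> is summed, the second goes to infinity.\<close>

lemma tannery_bound:
  fixes a :: "nat \<Rightarrow> nat \<Rightarrow> complex"
  assumes "\<And>k. (\<lambda>n. a k n) \<longlonglongrightarrow> b k" "\<And>k n. norm (a k n) \<le> M k" "summable M"
  shows "summable b" "(\<lambda>n. \<Sum>k. a k n) \<longlonglongrightarrow> (\<Sum>k. b k)"
proof -
  have "eventually (\<lambda>(k, n). norm (a k n) \<le> M k) (at_top \<times>\<^sub>F sequentially)"
    using assms(2) by (intro always_eventually) auto
  from tannerys_theorem[OF assms(1) this assms(3)]
  show "summable b" "(\<lambda>n. \<Sum>k. a k n) \<longlonglongrightarrow> (\<Sum>k. b k)"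
    by (auto intro: summable_norm_cancel)
qed

text \<open>The limit of \<open>finite_triple_product\<close>: for fixed \<open>n\<close> the
  Gaussian coefficients tend to 1 / (p;p)_inf. The annulus |p| < |a| < 1 supplies the geometric
  majorant for exchanging sum and limit.\<close>

theorem triple_product:
  assumes p: "p \<noteq> 0" "norm p < norm a" and a: "norm a < 1"
  shows "(\<lambda>n. (- 1) ^ n * p ^ (Suc n choose 2) * (1 / a ^ n - a ^ Suc n))
    sums (qshift_inf p p * qshift_inf a p * qshift_inf (p / a) p)"
proof -
  have p1: "norm p < 1" and a0: "a \<noteq> 0" and pa: "norm (p / a) < 1"
    using assms by (auto simp: norm_divide divide_simps)
  define w where "w n = (- 1) ^ n * p ^ (Suc n choose 2) * (1 / a ^ n - a ^ Suc n)" for n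
  \<comment> \<open>Zero beyond \<open>N\<close>, so that the finite sums become series over one
    index set.\<close>
  define f where "f n N = (if n \<le> N then qbinom p (2 * N + 1) (N - n) * w n else 0)" for n N
  note lim = qshift_tendsto[OF p1, of p] and nz = qshift_inf_nonzero[OF p1 p1]
  obtain B where B: "B > 0" "\<And>n. norm (qshift p p n) \<le> B"
    using bounded_if_tendsto[OF lim] by blast
  \<comment> \<open>The inverses are bounded because the limit (p;p)_inf is nonzero.\<close>
  obtain C where C: "C > 0" "\<And>n. norm (inverse (qshift p p n)) \<le> C"
    using bounded_if_tendsto[OF tendsto_inverse[OF lim nz]] by blast
  have f_lim: "f n \<longlonglongrightarrow> inverse (qshift_inf p p) * w n" for n
  proof -
    have "(\<lambda>N. qshift p p (2 * N + 1) * inverse (qshift p p (N - n)) * inverse (qshift p p (N + Suc n)) * w n)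
      \<longlonglongrightarrow> qshift_inf p p * inverse (qshift_inf p p) * inverse (qshift_inf p p) * w n"
    proof (intro tendsto_intros nz)
      show "(\<lambda>N. qshift p p (2 * N + 1)) \<longlonglongrightarrow> qshift_inf p p"
        by (rule filterlim_compose[OF lim]) (auto intro!: filterlim_subseq simp: strict_mono_def)
      show "(\<lambda>N. qshift p p (N - n)) \<longlonglongrightarrow> qshift_inf p p"
        by (rule filterlim_compose[OF lim]) (rule filterlim_minus_const_nat_at_top)
      show "(\<lambda>N. qshift p p (N + Suc n)) \<longlonglongrightarrow> qshift_inf p p"
        by (rule filterlim_compose[OF lim]) (rule filterlim_add_const_nat_at_top)
    qed
    moreover have "eventually (\<lambda>N. qshift p p (2 * N + 1) * inverse (qshift p p (N - n)) * inverse (qshift p p (N + Suc n)) * w n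
       = f n N) sequentially"
      using eventually_ge_at_top[of n]
    proof eventually_elim
      case (elim N)
      then obtain d where N: "N = n + d" by (auto simp: le_iff_add)
      have "2 * N + 1 - (N - n) = N + Suc n" by (simp add: N)
      moreover have "N - n \<le> 2 * N + 1" by (simp add: N)
      ultimately show ?case using elim unfolding f_def qbinom_def
        by (simp add: divide_simps del: qshift_Suc)
    qed
    ultimately show ?thesis
      using nz by (auto dest: Lim_transform_eventually)
  qed
  have f_bound: "norm (f n N) \<le> B * C * C * (norm (p / a) ^ n + norm p ^ n)" for n N
  proof (cases "n \<le> N")
    case True
    have "norm (f n N) = norm (qshift p p (2 * N + 1)) * norm (inverse (qshift p p (N - n)))
        * norm (inverse (qshift p p (2 * N + 1 - (N - n)))) * norm (w n)"
      using True by (simp add: f_def qbinom_def norm_mult norm_divide norm_inverse divide_simps del: qshift_Suc)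
    also have "\<dots> \<le> B * C * C * (norm (p / a) ^ n + norm p ^ n)"
      using B C theta_term_bound[OF p1 a0 a, of n]
      by (intro mult_mono mult_nonneg_nonneg) (auto simp: w_def simp del: qshift_Suc intro: less_imp_le)
    finally show ?thesis .
  next
    case False
    thus ?thesis using B C by (simp add: f_def)
  qed
  have sm: "summable (\<lambda>n. B * C * C * (norm (p / a) ^ n + norm p ^ n))"
    using pa p1 by (intro summable_mult summable_add summable_geometric) auto
  note T = tannery_bound[OF f_lim f_bound sm]
  have "(\<Sum>n. f n N) = qshift (p / a) p N * qshift a p (Suc N)" for N
  proof -
    have "(\<Sum>n. f n N) = (\<Sum>n\<le>N. f n N)"
      by (rule suminf_finite) (auto simp: f_def)
    thus ?thesis using finite_triple_product[OF p1 p(1) a0, of N]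
      by (simp add: f_def w_def del: qshift_Suc)
  qed
  moreover have "(\<lambda>N. qshift (p / a) p N * qshift a p (Suc N)) \<longlonglongrightarrow> qshift_inf (p / a) p * qshift_inf a p"
    by (intro tendsto_intros qshift_tendsto p1 LIMSEQ_Suc)
  ultimately have "(\<Sum>n. inverse (qshift_inf p p) * w n) = qshift_inf (p / a) p * qshift_inf a p"
    using T(2) LIMSEQ_unique by simp
  hence "(\<lambda>n. inverse (qshift_inf p p) * w n) sums (qshift_inf (p / a) p * qshift_inf a p)"
    using T(1) by (simp add: sums_iff)
  from sums_mult[OF this, of "qshift_inf p p"]
  have "w sums (qshift_inf p p * (qshift_inf (p / a) p * qshift_inf a p))"
    using nz by (simp flip: mult.assoc)
  thus ?thesis
    by (simp only: w_def[abs_def] mult_ac)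
qed

section \<open>The three-term recurrence\<close>

text \<open>A discrete Gronwall estimate run from infinity. When \<open>m\<close> drops by one, the
  larger of two consecutive differences grows by a factor of at most 1 + e_m, hence at most
  exp(e_m). Summability bounds the accumulated factor, while the differences at \<open>m + N\<close>
  tend to 0.\<close>

lemma recurrence_unique:
  fixes u v \<alpha> \<beta> :: "nat \<Rightarrow> complex"
  assumes sm: "summable (\<lambda>m. norm (\<alpha> m) + norm (\<beta> m))"
    and u: "\<And>m. u m = (1 + \<alpha> m) * u (m + 1) + \<beta> m * u (m + 2)" "u \<longlonglongrightarrow> l"
    and v: "\<And>m. v m = (1 + \<alpha> m) * v (m + 1) + \<beta> m * v (m + 2)" "v \<longlonglongrightarrow> l"
  shows "u m = v m"
proof -
  define e where "e m = norm (\<alpha> m) + norm (\<beta> m)" for m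
  define H where "H m = u m - v m" for m
  define M where "M m = max (norm (H m)) (norm (H (Suc m)))" for m
  have e0: "e m \<ge> 0" for m by (simp add: e_def)
  have M0: "M m \<ge> 0" for m by (simp add: M_def le_max_iff_disj)
  have H0: "H \<longlonglongrightarrow> 0"
    using tendsto_diff[OF u(2) v(2)] by (simp add: H_def[abs_def])
  have M_lim: "M \<longlonglongrightarrow> 0"
    using tendsto_max[OF tendsto_norm_zero[OF H0] tendsto_norm_zero[OF LIMSEQ_Suc[OF H0]]]
    by (simp add: M_def[abs_def])
  have step: "M m \<le> (1 + e m) * M (Suc m)" for m
  proof -
    have "H m = (1 + \<alpha> m) * H (Suc m) + \<beta> m * H (Suc (Suc m))"
      unfolding H_def u(1)[of m] v(1)[of m] by (simp add: algebra_simps)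
    also have "norm \<dots> \<le> (1 + norm (\<alpha> m)) * norm (H (Suc m)) + norm (\<beta> m) * norm (H (Suc (Suc m)))"
      by (intro norm_triangle_le add_mono)
         (auto simp: norm_mult intro!: mult_right_mono norm_triangle_le)
    also have "\<dots> \<le> (1 + norm (\<alpha> m)) * M (Suc m) + norm (\<beta> m) * M (Suc m)"
      by (intro add_mono mult_left_mono) (auto simp: M_def)
    finally have "norm (H m) \<le> (1 + e m) * M (Suc m)"
      by (simp add: e_def algebra_simps)
    moreover have "norm (H (Suc m)) \<le> (1 + e m) * M (Suc m)"
    proof -
      have "norm (H (Suc m)) \<le> M (Suc m)" by (simp add: M_def)
      also have "\<dots> \<le> (1 + e m) * M (Suc m)"
        using e0[of m] M0[of "Suc m"] by (simp add: algebra_simps)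
      finally show ?thesis .
    qed
    ultimately show ?thesis by (simp add: M_def)
  qed
  have iter: "M m \<le> exp (\<Sum>k<N. e (k + m)) * M (m + N)" for N
  proof (induction N)
    case (Suc N)
    have "M m \<le> exp (\<Sum>k<N. e (k + m)) * M (m + N)" by (fact Suc.IH)
    also have "\<dots> \<le> exp (\<Sum>k<N. e (k + m)) * (exp (e (m + N)) * M (Suc (m + N)))"
      by (intro mult_left_mono order.trans[OF step] mult_right_mono exp_ge_add_one_self M0) auto
    finally show ?case by (simp add: exp_add add_ac mult_ac)
  qed simp
  have sm': "summable (\<lambda>k. e (k + m))"
    using sm unfolding e_def by (rule summable_ignore_initial_segment)
  have bound: "M m \<le> exp (\<Sum>k. e (k + m)) * M (m + N)" for N
    using iter[of N] sum_le_suminf[OF sm', of "{..<N}"] e0 M0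
    by (meson exp_le_cancel_iff finite_lessThan mult_right_mono order.trans)
  have "(\<lambda>N. M (m + N)) \<longlonglongrightarrow> 0"
    using LIMSEQ_ignore_initial_segment[OF M_lim, of m] by (simp add: add.commute)
  from tendsto_mult_left[OF this, of "exp (\<Sum>k. e (k + m))"]
  have "(\<lambda>N. exp (\<Sum>k. e (k + m)) * M (m + N)) \<longlonglongrightarrow> 0" by simp
  hence "M m \<le> 0"
    by (rule LIMSEQ_le_const) (use bound in auto)
  hence "norm (H m) \<le> 0"
    unfolding M_def by (meson max.cobounded1 order.trans)
  thus ?thesis by (simp add: H_def)
qed

text \<open>The polynomial \<open>s\<close> was found by solving for the certificate of the telescoping sum
  in lemma \<open>wp_sum_rec\<close> below, coefficient by coefficient in \<open>y\<close>. In the application,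
  \<open>x = q ^ (2 * m)\<close> and \<open>y = q ^ (2 * n)\<close>.\<close>

lemma certificate_identity:
  fixes q x y :: complex
  defines "K \<equiv> \<lambda>x. 1 + x * y * q - x ^ 2 * y ^ 3 * q ^ 3 * (1 + q * y)"
    and "s \<equiv> \<lambda>y. 1 + (1 + x * q + x * q ^ 3) * y + (x * q ^ 3 + x ^ 2 * q ^ 4) * y ^ 2
      + x * q ^ 2 * y ^ 3 - x ^ 2 * q ^ 4 * y ^ 4"
  shows "(1 + x * y * q ^ 3) * (1 + x * y * q ^ 5) * K x
      - (1 + x * q) * (y ^ 2 * (1 - x * y * q ^ 2) * (1 + x * y * q ^ 5) * K (x * q ^ 2))
      - x * q ^ 2 * (y ^ 4 * (1 - x * y * q ^ 2) * (1 - x * y * q ^ 4) * K (x * q ^ 4))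
    = x ^ 2 * q ^ 5 * y ^ 4 * (1 + q * y) * (1 - x * y * q ^ 2) * s (q ^ 2 * y)
      + (1 - y) * (1 + x * y * q ^ 5) * s y"
  unfolding K_def s_def by algebra

section \<open>Coefficients and tails of the infinite products\<close>

context
  fixes q :: complex
  assumes q0: "q \<noteq> 0" and q1: "norm q < 1"
begin

lemma norm_power_less_1: "n > 0 \<Longrightarrow> norm (q ^ n) < 1"
  using q1 by (simp add: norm_power power_less_one_iff)

lemma norm_power_le_1: "norm (q ^ n) \<le> 1"
  using q1 by (simp add: norm_power power_le_one)

lemma one_minus_power_nonzero: "n > 0 \<Longrightarrow> 1 - q ^ n \<noteq> 0"
  by (rule one_minus_nonzero[OF norm_power_less_1])

lemma one_plus_power_nonzero: "n > 0 \<Longrightarrow> 1 + q ^ n \<noteq> 0"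
  using one_minus_nonzero[of "- (q ^ n)"] norm_power_less_1[of n] by simp

definition gg_coeff where "gg_coeff n = qshift (- q) (q ^ 2) n / qshift (q ^ 2) (q ^ 2) n"

text \<open>This and \<open>even_tail\<close> are the infinite products of the very-well-poised
  series at x = q^(2m): index \<open>m + n\<close> gives (-xq^(2n+1);q^2)_inf and
  (xq^(2n+2);q^2)_inf. Steps in \<open>m\<close> and in \<open>n\<close> thus have the same effect
  on them.\<close>

definition neg_odd_tail where "neg_odd_tail k = qshift_inf (- q * (q ^ 2) ^ k) (q ^ 2)"

definition even_tail where "even_tail k = qshift_inf (q ^ 2 * (q ^ 2) ^ k) (q ^ 2)"

lemma gg_coeff_Suc: "gg_coeff (Suc n) = gg_coeff n * (1 + q ^ (2 * n + 1)) / (1 - q ^ (2 * n + 2))"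
  by (simp add: gg_coeff_def power_mult power2_eq_square mult_ac flip: power_mult_distrib)

lemma gg_coeff_0 [simp]: "gg_coeff 0 = 1"
  by (simp add: gg_coeff_def)

lemma neg_odd_tail_rec: "neg_odd_tail k = (1 + q ^ (2 * k + 1)) * neg_odd_tail (Suc k)"
proof -
  have "1 + q ^ (2 * k + 1) = 1 - - q * (q ^ 2) ^ k" "- q * (q ^ 2) ^ Suc k = - q * (q ^ 2) ^ k * q ^ 2"
    by (simp_all add: power_mult)
  thus ?thesis
    unfolding neg_odd_tail_def using qshift_inf_rec[OF norm_power_less_1, of 2 "- q * (q ^ 2) ^ k"]
    by (simp only: zero_less_numeral)
qed

lemma even_tail_rec: "even_tail k = (1 - q ^ (2 * k + 2)) * even_tail (Suc k)"
proof -
  have "q ^ (2 * k + 2) = q ^ 2 * (q ^ 2) ^ k"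
    unfolding power_add power_mult by (rule mult.commute)
  moreover have "q ^ 2 * (q ^ 2) ^ Suc k = q ^ 2 * (q ^ 2) ^ k * q ^ 2"
    by (simp only: power_Suc mult_ac)
  ultimately show ?thesis
    unfolding even_tail_def using qshift_inf_rec[OF norm_power_less_1, of 2 "q ^ 2 * (q ^ 2) ^ k"]
    by (simp only: zero_less_numeral)
qed

lemma even_tail_nonzero: "even_tail k \<noteq> 0"
  unfolding even_tail_def
  by (intro qshift_inf_nonzero norm_mult_power_less_1 norm_power_less_1) auto

lemma neg_odd_tail_lim: "neg_odd_tail \<longlonglongrightarrow> 1"
  unfolding neg_odd_tail_def using q1 by (intro qshift_inf_power_tendsto norm_power_less_1) auto

lemma even_tail_lim: "even_tail \<longlonglongrightarrow> 1"
  unfolding even_tail_def by (intro qshift_inf_power_tendsto norm_power_less_1) auto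

lemma gg_coeff_lim: "gg_coeff \<longlonglongrightarrow> neg_odd_tail 0 / even_tail 0"
proof -
  have "gg_coeff \<longlonglongrightarrow> qshift_inf (- q) (q ^ 2) / qshift_inf (q ^ 2) (q ^ 2)"
    unfolding gg_coeff_def by (intro tendsto_intros qshift_tendsto qshift_inf_nonzero norm_power_less_1) auto
  thus ?thesis by (simp add: neg_odd_tail_def even_tail_def)
qed

lemma neg_odd_tail_split: "qshift (- q) (q ^ 2) n * neg_odd_tail n = neg_odd_tail 0"
  unfolding neg_odd_tail_def using qshift_inf_split[OF norm_power_less_1, of 2 "- q" n] by simp

lemma even_tail_split: "qshift (q ^ 2) (q ^ 2) n * even_tail n = even_tail 0"
  unfolding even_tail_def using qshift_inf_split[OF norm_power_less_1, of 2 "q ^ 2" n] by simp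

text \<open>The finite products in \<open>gg_coeff\<close> complete both tails to full products. Up
  to this constant, \<open>wp_term\<close> then reduces to powers of \<open>q\<close> at
  \<open>m = 0\<close> and to a rational function of such powers at \<open>m = 1\<close>.\<close>

lemma gg_coeff_tails: "gg_coeff n * neg_odd_tail n / even_tail n = neg_odd_tail 0 / even_tail 0"
proof -
  have "qshift (q ^ 2) (q ^ 2) n \<noteq> 0"
    by (intro qshift_nonzero norm_power_less_1) auto
  thus ?thesis using even_tail_nonzero[of 0] even_tail_nonzero[of n]
    unfolding gg_coeff_def neg_odd_tail_split[symmetric, of n] even_tail_split[symmetric, of n] by (simp add: field_simps)
qed

text \<open>The first inequality on \<open>e\<close> gives a majorant independent of
  \<open>m\<close>; the second makes every term except the one at \<open>n = 0\<close> vanish in the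
  limit.\<close>

lemma series_tendsto_1:
  fixes a :: "nat \<Rightarrow> nat \<Rightarrow> complex"
  assumes bound: "\<And>m n. norm (a m n) \<le> C * norm q ^ e m n"
    and e: "\<And>m n. n \<le> e m n" "\<And>m n. n > 0 \<Longrightarrow> m \<le> e m n"
    and lim0: "(\<lambda>m. a m 0) \<longlonglongrightarrow> 1"
  shows "summable (a m)" "(\<lambda>m. \<Sum>n. a m n) \<longlonglongrightarrow> 1"
proof -
  have C: "C \<ge> 0"
  proof -
    have "norm q ^ e 0 0 > 0" using q0 by simp
    thus ?thesis using order.trans[OF norm_ge_zero bound[of 0 0]] by (auto simp: zero_le_mult_iff)
  qed
  have le: "norm (a m n) \<le> C * norm q ^ k" if "k \<le> e m n" for m n k
    using that q1 C by (intro order.trans[OF bound] mult_left_mono power_decreasing) auto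
  have M: "summable (\<lambda>n. C * norm q ^ n)"
    using q1 by (intro summable_mult summable_geometric) auto
  show "summable (a m)"
    by (rule summable_comparison_test'[OF M, of 0]) (use le e in auto)
  have lim: "(\<lambda>m. a m n) \<longlonglongrightarrow> (if n = 0 then 1 else 0)" for n
  proof (cases "n = 0")
    case False
    have "(\<lambda>m. C * norm q ^ m) \<longlonglongrightarrow> C * 0"
      using q1 by (intro tendsto_intros LIMSEQ_power_zero) auto
    hence "(\<lambda>m. C * norm q ^ m) \<longlonglongrightarrow> 0" by simp
    moreover have "\<forall>m. norm (a m n) \<le> C * norm q ^ m"
      using False by (blast intro: le e(2))
    ultimately have "(\<lambda>m. a m n) \<longlonglongrightarrow> 0"
      by (rule Lim_null_comparison[OF always_eventually, rotated])
    thus ?thesis using False by simp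
  qed (use lim0 in simp)
  have "(\<lambda>m. \<Sum>n. a m n) \<longlonglongrightarrow> (\<Sum>n. if n = 0 then 1 else 0)"
    by (rule tannery_bound(2)[OF lim _ M]) (use le e in auto)
  also have "(\<Sum>n. if n = 0 then 1 else 0 :: complex) = 1"
    using suminf_finite[of "{0}" "\<lambda>n::nat. if n = 0 then 1 else 0 :: complex"] by simp
  finally show "(\<lambda>m. \<Sum>n. a m n) \<longlonglongrightarrow> 1" .
qed

section \<open>The Goellnitz-Gordon series\<close>

definition gg_term where "gg_term m n = gg_coeff n * q ^ (n ^ 2 + 2 * m * n)"

definition gg_sum where "gg_sum m = (\<Sum>n. gg_term m n)"

lemma gg_sum_summable: "summable (gg_term m)" and gg_sum_lim: "gg_sum \<longlonglongrightarrow> 1"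
proof -
  obtain C where C: "C > 0" "\<And>n. norm (gg_coeff n) \<le> C"
    using bounded_if_tendsto[OF gg_coeff_lim] by blast
  have 1: "norm (gg_term m n) \<le> C * norm q ^ (n ^ 2 + 2 * m * n)" for m n
    using C by (auto simp: gg_term_def norm_mult norm_power intro!: mult_right_mono)
  have 2: "n \<le> n ^ 2 + 2 * m * n" for m n :: nat
    by (simp add: power2_eq_square trans_le_add1)
  have 3: "m \<le> n ^ 2 + 2 * m * n" if "n > 0" for m n :: nat
    using that by (simp add: trans_le_add2)
  have 4: "(\<lambda>m. gg_term m 0) \<longlonglongrightarrow> 1"
    by (simp add: gg_term_def)
  show "summable (gg_term m)"
    by (rule series_tendsto_1(1)[OF 1 2 3 4])
  show "gg_sum \<longlonglongrightarrow> 1"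
    unfolding gg_sum_def by (rule series_tendsto_1(2)[OF 1 2 3 4])
qed

lemma power_exponent_tendsto_0:
  fixes e :: "nat \<Rightarrow> nat"
  assumes "\<And>n. n \<le> e n"
  shows "(\<lambda>n. q ^ e n) \<longlonglongrightarrow> 0"
proof (rule Lim_null_comparison[OF always_eventually])
  show "\<forall>n. norm (q ^ e n) \<le> norm q ^ n"
    using assms q1 by (auto simp: norm_power intro!: power_decreasing)
  show "(\<lambda>n. norm q ^ n) \<longlonglongrightarrow> 0"
    using q1 by (intro LIMSEQ_power_zero) auto
qed

text \<open>Since \<open>gg_term (m + 1) n\<close> is \<open>q ^ (2 * n)\<close> times
  \<open>gg_term m n\<close>, the \<open>Z n\<close> add up to S_m - S_(m+1). The factor
  \<open>1 - q ^ (2 * n)\<close> cancels the last factor of (q^2;q^2)_n; after an index shift, the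
  new factor 1 + q^(2n+1) of the numerator splits the sum into q^(2m+1) S_(m+1) + q^(2m+2)
  S_(m+2).\<close>

lemma gg_sum_rec: "gg_sum m = (1 + q ^ (2 * m + 1)) * gg_sum (m + 1) + q ^ (2 * m + 2) * gg_sum (m + 2)"
proof -
  define Z where "Z n = gg_term m n * (1 - q ^ (2 * n))" for n
  have "Z \<longlonglongrightarrow> 0 * (1 - 0)"
    unfolding Z_def
    by (intro tendsto_intros summable_LIMSEQ_zero gg_sum_summable power_exponent_tendsto_0) auto
  hence "(\<lambda>n. Z n - Z (Suc n)) sums (Z 0 - 0)"
    by (intro telescope_sums') auto
  moreover have "Z n - Z (Suc n) = gg_term m n - (1 + q ^ (2 * m + 1)) * gg_term (m + 1) n
      - q ^ (2 * m + 2) * gg_term (m + 2) n" for n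
  proof -
    define y where "y = q ^ (2 * n)"
    have d: "1 - q ^ 2 * y \<noteq> 0"
      using one_minus_power_nonzero[of "2 * n + 2"] by (simp add: y_def power2_eq_square mult_ac)
    have y': "q ^ (2 * Suc n) = q ^ 2 * y" "q ^ (2 * n + 1) = q * y" "q ^ (2 * n + 2) = q ^ 2 * y"
      by (simp_all add: y_def power2_eq_square)
    have e: "q ^ (n ^ 2 + 2 * (m + 1) * n) = q ^ (n ^ 2 + 2 * m * n) * y"
      "q ^ (n ^ 2 + 2 * (m + 2) * n) = q ^ (n ^ 2 + 2 * m * n) * y ^ 2"
      "q ^ (Suc n ^ 2 + 2 * m * Suc n) = q ^ (n ^ 2 + 2 * m * n) * (q ^ (2 * m + 1) * y)"
      unfolding y_def power_mult[symmetric] power_add[symmetric]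
      by (rule arg_cong[of _ _ "\<lambda>e. q ^ e"]; simp add: algebra_simps power2_eq_square)+
    have "Z (Suc n) = gg_term m n * (1 + q * y) * q ^ (2 * m + 1) * y"
      unfolding Z_def gg_term_def gg_coeff_Suc y' e using d by (simp add: mult_ac)
    moreover define R where "R = q ^ (2 * m + 1)"
    moreover have "q ^ (2 * m + 2) = q * R" by (simp add: R_def)
    moreover have "gg_term (m + 1) n = gg_term m n * y" "gg_term (m + 2) n = gg_term m n * y ^ 2"
      "Z n = gg_term m n * (1 - y)"
      unfolding Z_def gg_term_def e y_def[symmetric] by simp_all
    ultimately show ?thesis
      by (simp add: algebra_simps power2_eq_square del: power_Suc)
  qed
  moreover have "(\<lambda>n. gg_term m n - (1 + q ^ (2 * m + 1)) * gg_term (m + 1) n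
      - q ^ (2 * m + 2) * gg_term (m + 2) n) sums
      (gg_sum m - (1 + q ^ (2 * m + 1)) * gg_sum (m + 1) - q ^ (2 * m + 2) * gg_sum (m + 2))"
    unfolding gg_sum_def by (intro sums_diff sums_mult summable_sums gg_sum_summable)
  ultimately have "Z 0 - 0 = gg_sum m - (1 + q ^ (2 * m + 1)) * gg_sum (m + 1) - q ^ (2 * m + 2) * gg_sum (m + 2)"
    using sums_unique2 by simp
  thus ?thesis by (simp add: Z_def algebra_simps)
qed

section \<open>The very-well-poised series\<close>

text \<open>With \<open>x = q ^ (2 * m)\<close>, \<open>wp_term m n\<close> comes from the very-well-poised series
  $\sum_n (-1)^n x^{2n} q^{4n^2-n} (-q;q^2)_n (1 - x q^{4n}) (-xq^{2n+1};q^2)_\infty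
  / ((q^2;q^2)_n (xq^{2n};q^2)_\infty)$ by writing $1 - xq^{4n} = (1 - q^{2n}) + q^{2n}(1 - xq^{2n})$
  and shifting the index in the first part. Unlike that series, it has no $0/0$ at $x = 1$, $n = 0$.\<close>

definition wp_factor where
  "wp_factor m n = 1 + q ^ (2 * m + 2 * n + 1) - q ^ (4 * m + 6 * n + 3) * (1 + q ^ (2 * n + 1))"

definition wp_term where
  "wp_term m n = (- 1) ^ n * q ^ (4 * m * n + 4 * n ^ 2 + n) * gg_coeff n * neg_odd_tail (m + n + 1) / even_tail (m + n) * wp_factor m n"

definition wp_sum where "wp_sum m = (\<Sum>n. wp_term m n)"

lemma wp_sum_summable: "summable (wp_term m)" and wp_sum_lim: "wp_sum \<longlonglongrightarrow> 1"
proof -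
  obtain B where B: "B > 0" "\<And>n. norm (gg_coeff n) \<le> B"
    using bounded_if_tendsto[OF gg_coeff_lim] by blast
  obtain G where G: "G > 0" "\<And>n. norm (neg_odd_tail n) \<le> G"
    using bounded_if_tendsto[OF neg_odd_tail_lim] by blast
  obtain H where H: "H > 0" "\<And>n. norm (inverse (even_tail n)) \<le> H"
    using bounded_if_tendsto[OF tendsto_inverse[OF even_tail_lim]] by (metis zero_neq_one)
  have wp_factor: "norm (wp_factor m n) \<le> 4" for m n
  proof -
    have "norm (1 + a - b * (1 + d)) \<le> 4" if "norm a \<le> 1" "norm b \<le> 1" "norm d \<le> 1" for a b d :: complex
    proof -
      have "norm (1 + a) \<le> 2" "norm (1 + d) \<le> 2"
        using norm_triangle_ineq[of 1 a] norm_triangle_ineq[of 1 d] that by simp_all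
      moreover from this have "norm (b * (1 + d)) \<le> 1 * 2"
        unfolding norm_mult using that by (intro mult_mono) auto
      ultimately show ?thesis
        using norm_triangle_ineq4[of "1 + a" "b * (1 + d)"] by linarith
    qed
    thus ?thesis unfolding wp_factor_def using norm_power_le_1 by blast
  qed
  have 1: "norm (wp_term m n) \<le> B * G * H * 4 * norm q ^ (4 * m * n + 4 * n ^ 2 + n)" for m n
  proof -
    have "norm (wp_term m n) = norm (gg_coeff n) * norm (neg_odd_tail (m + n + 1)) * norm (inverse (even_tail (m + n))) * norm (wp_factor m n)
        * norm q ^ (4 * m * n + 4 * n ^ 2 + n)"
      by (simp add: wp_term_def norm_mult norm_divide norm_power norm_inverse divide_inverse mult_ac)
    also have "\<dots> \<le> B * G * H * 4 * norm q ^ (4 * m * n + 4 * n ^ 2 + n)"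
      using B G H wp_factor by (intro mult_mono mult_nonneg_nonneg) (auto intro: less_imp_le)
    finally show ?thesis .
  qed
  have 2: "n \<le> 4 * m * n + 4 * n ^ 2 + n" for m n :: nat by simp
  have 3: "m \<le> 4 * m * n + 4 * n ^ 2 + n" if "n > 0" for m n :: nat
    using that by (simp add: trans_le_add1)
  have 4: "(\<lambda>m. wp_term m 0) \<longlonglongrightarrow> 1"
  proof -
    have "(\<lambda>m. neg_odd_tail (m + 1) / even_tail m * (1 + q ^ (2 * m + 1) - q ^ (4 * m + 3) * (1 + q)))
      \<longlonglongrightarrow> 1 / 1 * (1 + 0 - 0 * (1 + q))"
      by (intro tendsto_intros neg_odd_tail_lim even_tail_lim LIMSEQ_ignore_initial_segment power_exponent_tendsto_0) auto
    thus ?thesis by (simp add: wp_term_def wp_factor_def)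
  qed
  show "summable (wp_term m)"
    by (rule series_tendsto_1(1)[OF 1 2 3 4])
  show "wp_sum \<longlonglongrightarrow> 1"
    unfolding wp_sum_def by (rule series_tendsto_1(2)[OF 1 2 3 4])
qed

text \<open>Telescoping with certificate \<open>Z\<close>. Its factor \<open>1 - q ^ (2 * n)\<close>
  makes \<open>Z 0\<close> vanish and cancels the denominator that \<open>gg_coeff\<close> gains in
  \<open>Z (Suc n)\<close>; once a common factor is removed, the termwise identity is
  \<open>certificate_identity\<close>.\<close>

lemma wp_sum_rec: "wp_sum m = (1 + q ^ (2 * m + 1)) * wp_sum (m + 1) + q ^ (2 * m + 2) * wp_sum (m + 2)"
proof -
  define x where "x = q ^ (2 * m)"
  define s where "s y = 1 + (1 + x * q + x * q ^ 3) * y + (x * q ^ 3 + x ^ 2 * q ^ 4) * y ^ 2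
      + x * q ^ 2 * y ^ 3 - x ^ 2 * q ^ 4 * y ^ 4" for y
  define Z where "Z n = (- 1) ^ n * q ^ (4 * m * n + 4 * n ^ 2 + n) * gg_coeff n * (1 - q ^ (2 * n))
      * neg_odd_tail (m + n + 2) / even_tail (m + n) * s (q ^ (2 * n))" for n
  have Z_lim: "Z \<longlonglongrightarrow> 0"
  proof -
    have 1: "(\<lambda>n. q ^ (2 * n)) \<longlonglongrightarrow> 0" by (intro power_exponent_tendsto_0) auto
    have 2: "(\<lambda>n. (- 1) ^ n * q ^ (4 * m * n + 4 * n ^ 2 + n)) \<longlonglongrightarrow> 0"
      using tendsto_norm_zero[OF power_exponent_tendsto_0, of "\<lambda>n. 4 * m * n + 4 * n ^ 2 + n"]
      by (intro tendsto_norm_zero_cancel[of "\<lambda>n. (- 1) ^ n * _ n"]) (simp add: norm_mult norm_power)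
    have 3: "(\<lambda>n. neg_odd_tail (m + n + 2)) \<longlonglongrightarrow> 1" "(\<lambda>n. even_tail (m + n)) \<longlonglongrightarrow> 1"
      using LIMSEQ_ignore_initial_segment[OF neg_odd_tail_lim, of "m + 2"] LIMSEQ_ignore_initial_segment[OF even_tail_lim, of m]
      by (simp_all add: add_ac)
    have "(\<lambda>n. s (q ^ (2 * n))) \<longlonglongrightarrow> s 0"
      unfolding s_def by (intro tendsto_intros 1)
    from tendsto_mult[OF tendsto_divide[OF tendsto_mult[OF tendsto_mult[OF tendsto_mult[OF 2 gg_coeff_lim]
      tendsto_diff[OF tendsto_const 1]] 3(1)] 3(2)] this]
    show ?thesis unfolding Z_def by simp
  qed
  have Z: "wp_term m n - (1 + q ^ (2 * m + 1)) * wp_term (m + 1) n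
      - q ^ (2 * m + 2) * wp_term (m + 2) n = Z n - Z (Suc n)" for n
  proof -
    define y where "y = q ^ (2 * n)"
    define w where "w = (- 1) ^ n * q ^ (4 * m * n + 4 * n ^ 2 + n)"
    define u where "u = 1 - x * y * q ^ 2"
    define v where "v = 1 - x * y * q ^ 4"
    define k where "k x = 1 + x * y * q - x ^ 2 * y ^ 3 * q ^ 3 * (1 + q * y)" for x
    \<comment> \<open>All tails are brought to the highest indices that occur, those of
      \<open>wp_term (m + 2) n\<close>. What remains next to \<open>W / (u * v)\<close> is
      polynomial in \<open>q\<close>, \<open>x\<close> and \<open>y\<close>.\<close>
    define W where "W = w * gg_coeff n * neg_odd_tail (m + n + 3) / even_tail (m + n + 2)"
    have uv: "u \<noteq> 0" "v \<noteq> 0"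
      using one_minus_power_nonzero[of "2 * m + 2 * n + 2"] one_minus_power_nonzero[of "2 * m + 2 * n + 4"]
      by (simp_all add: u_def v_def x_def y_def power_add power2_eq_square mult_ac)
    have d: "1 - y * q ^ 2 \<noteq> 0"
      using one_minus_power_nonzero[of "2 * n + 2"] by (simp add: y_def power2_eq_square mult_ac)
    have g2: "neg_odd_tail (m + n + 2) = (1 + x * y * q ^ 5) * neg_odd_tail (m + n + 3)"
      using neg_odd_tail_rec[of "m + n + 2"] by (simp add: x_def y_def power_add eval_nat_numeral mult_ac)
    have g1: "neg_odd_tail (m + n + 1) = (1 + x * y * q ^ 3) * (1 + x * y * q ^ 5) * neg_odd_tail (m + n + 3)"
      using neg_odd_tail_rec[of "m + n + 1"] g2 by (simp add: x_def y_def power_add eval_nat_numeral mult_ac)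
    have h1: "even_tail (m + n + 1) = v * even_tail (m + n + 2)"
      using even_tail_rec[of "m + n + 1"] by (simp add: v_def x_def y_def power_add eval_nat_numeral mult_ac)
    have h0: "even_tail (m + n) = u * v * even_tail (m + n + 2)"
      using even_tail_rec[of "m + n"] h1 by (simp add: u_def x_def y_def power_add eval_nat_numeral mult_ac)
    have wp_factor: "wp_factor m n = k x" "wp_factor (m + 1) n = k (x * q ^ 2)" "wp_factor (m + 2) n = k (x * q ^ 4)"
      unfolding wp_factor_def k_def x_def y_def
      by (simp_all add: power_add power_mult_distrib eval_nat_numeral mult_ac flip: power_mult)
    have e1: "q ^ (4 * (m + 1) * n + 4 * n ^ 2 + n) = q ^ (4 * m * n + 4 * n ^ 2 + n) * y ^ 2"
      and e2: "q ^ (4 * (m + 2) * n + 4 * n ^ 2 + n) = q ^ (4 * m * n + 4 * n ^ 2 + n) * y ^ 4"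
      and e3: "q ^ (4 * m * Suc n + 4 * (Suc n) ^ 2 + Suc n)
        = q ^ (4 * m * n + 4 * n ^ 2 + n) * (x ^ 2 * q ^ 5 * y ^ 4)"
      unfolding x_def y_def power_mult[symmetric] power_add[symmetric]
      by (rule arg_cong[of _ _ "\<lambda>e. q ^ e"]; simp add: algebra_simps power2_eq_square)+
    have t0: "wp_term m n = W / (u * v) * ((1 + x * y * q ^ 3) * (1 + x * y * q ^ 5) * k x)"
      unfolding wp_term_def wp_factor g1 h0 W_def w_def[symmetric] by (simp add: mult_ac)
    have "wp_term (m + 1) n = w * y ^ 2 * gg_coeff n * neg_odd_tail (m + n + 2) / even_tail (m + n + 1) * k (x * q ^ 2)"
      unfolding wp_term_def wp_factor e1 w_def by (simp add: add_ac)
    hence t1: "wp_term (m + 1) n = W / (u * v) * (y ^ 2 * u * (1 + x * y * q ^ 5) * k (x * q ^ 2))"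
      unfolding g2 h1 W_def using uv by (simp add: mult_ac)
    have "wp_term (m + 2) n = w * y ^ 4 * gg_coeff n * neg_odd_tail (m + n + 3) / even_tail (m + n + 2) * k (x * q ^ 4)"
      unfolding wp_term_def wp_factor e2 w_def by (simp add: add_ac eval_nat_numeral)
    hence t2: "wp_term (m + 2) n = W / (u * v) * (y ^ 4 * u * v * k (x * q ^ 4))"
      unfolding W_def using uv by (simp add: mult_ac)
    have Z0: "Z n = W / (u * v) * ((1 - y) * (1 + x * y * q ^ 5) * s y)"
      unfolding Z_def g2 h0 W_def w_def[symmetric] y_def[symmetric] by (simp add: mult_ac)
    have y': "q ^ (2 * Suc n) = q ^ 2 * y" "q ^ (2 * n + 1) = q * y" "q ^ (2 * n + 2) = q ^ 2 * y"
      by (simp_all add: y_def power2_eq_square)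
    have "Z (Suc n) = - (w * (x ^ 2 * q ^ 5 * y ^ 4)) * (gg_coeff n * (1 + q * y) / (1 - q ^ 2 * y)) * (1 - q ^ 2 * y)
      * neg_odd_tail (m + n + 3) / even_tail (m + n + 1) * s (q ^ 2 * y)"
      unfolding Z_def e3 gg_coeff_Suc y' w_def by (simp add: add_ac eval_nat_numeral)
    also have "\<dots> = - (W / (u * v) * (x ^ 2 * q ^ 5 * y ^ 4 * (1 + q * y) * u * s (q ^ 2 * y)))"
      unfolding h1 W_def using uv d by (simp add: mult_ac)
    finally have Z1: "Z (Suc n) = - (W / (u * v) * (x ^ 2 * q ^ 5 * y ^ 4 * (1 + q * y) * u * s (q ^ 2 * y)))" .
    have "(1 + x * y * q ^ 3) * (1 + x * y * q ^ 5) * k x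
      - (1 + x * q) * (y ^ 2 * u * (1 + x * y * q ^ 5) * k (x * q ^ 2))
      - x * q ^ 2 * (y ^ 4 * u * v * k (x * q ^ 4))
      = x ^ 2 * q ^ 5 * y ^ 4 * (1 + q * y) * u * s (q ^ 2 * y) + (1 - y) * (1 + x * y * q ^ 5) * s y"
      unfolding u_def v_def k_def s_def by (rule certificate_identity)
    from arg_cong[OF this, of "\<lambda>z. W / (u * v) * z"]
    have "W / (u * v) * ((1 + x * y * q ^ 3) * (1 + x * y * q ^ 5) * k x)
      - (1 + x * q) * (W / (u * v) * (y ^ 2 * u * (1 + x * y * q ^ 5) * k (x * q ^ 2)))
      - x * q ^ 2 * (W / (u * v) * (y ^ 4 * u * v * k (x * q ^ 4)))
      = W / (u * v) * ((1 - y) * (1 + x * y * q ^ 5) * s y)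
       - - (W / (u * v) * (x ^ 2 * q ^ 5 * y ^ 4 * (1 + q * y) * u * s (q ^ 2 * y)))"
      by (simp only: right_diff_distrib distrib_left mult.left_commute diff_minus_eq_add add.commute)
    moreover have "q ^ (2 * m + 1) = x * q" "q ^ (2 * m + 2) = x * q ^ 2"
      by (simp_all add: x_def power2_eq_square)
    ultimately show ?thesis unfolding t0 t1 t2 Z0 Z1 by (simp only:)
  qed
  have "(\<lambda>n. Z n - Z (Suc n)) sums (Z 0 - 0)"
    by (rule telescope_sums'[OF Z_lim])
  moreover have "(\<lambda>n. wp_term m n - (1 + q ^ (2 * m + 1)) * wp_term (m + 1) n
      - q ^ (2 * m + 2) * wp_term (m + 2) n) sums
      (wp_sum m - (1 + q ^ (2 * m + 1)) * wp_sum (m + 1) - q ^ (2 * m + 2) * wp_sum (m + 2))"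
    unfolding wp_sum_def by (intro sums_diff sums_mult summable_sums wp_sum_summable)
  ultimately have "Z 0 - 0 = wp_sum m - (1 + q ^ (2 * m + 1)) * wp_sum (m + 1) - q ^ (2 * m + 2) * wp_sum (m + 2)"
    unfolding Z using sums_unique2 by blast
  thus ?thesis by (simp add: Z_def algebra_simps)
qed

lemma gg_sum_eq_wp_sum: "gg_sum m = wp_sum m"
proof (rule recurrence_unique[OF _ gg_sum_rec gg_sum_lim wp_sum_rec wp_sum_lim])
  have "summable (\<lambda>m. norm q ^ m)" using q1 by (intro summable_geometric) auto
  hence "summable (\<lambda>m. norm (q ^ (2 * m + k)))" for k
    by (rule summable_comparison_test'[of _ 0]) (use q1 in \<open>auto simp: norm_power intro!: power_decreasing\<close>)
  thus "summable (\<lambda>m. norm (q ^ (2 * m + 1)) + norm (q ^ (2 * m + 2)))"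
    by (intro summable_add)
qed


section \<open>Initial values\<close>

text \<open>Since (q^2;q^2)_inf = (q^2;q^4)_inf (q^4;q^4)_inf and (q^2;q^4)_inf = (q;q^2)_inf
  (-q;q^2)_inf, the numerator cancels. The remaining (q;q^2)_inf (q^4;q^4)_inf is split by residues
  modulo 8.\<close>

lemma tail_quotient:
  "neg_odd_tail 0 / even_tail 0 = 1 / (qshift_inf q (q ^ 8) * qshift_inf (q ^ 3) (q ^ 8) * qshift_inf (q ^ 5) (q ^ 8)
     * qshift_inf (q ^ 7) (q ^ 8) * qshift_inf (q ^ 4) (q ^ 8) * qshift_inf (q ^ 8) (q ^ 8))"
proof -
  have 1: "qshift_inf (q ^ 2) (q ^ 4) = qshift_inf q (q ^ 2) * neg_odd_tail 0"
    using qshift_inf_square[OF norm_power_less_1, of 2 q] by (simp add: neg_odd_tail_def flip: power_mult)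
  have 2: "even_tail 0 = qshift_inf (q ^ 2) (q ^ 4) * qshift_inf (q ^ 4) (q ^ 4)"
    using qshift_inf_dissect[OF norm_power_less_1, of 2 "q ^ 2"]
    by (simp add: even_tail_def flip: power_mult power_add)
  have 3: "qshift_inf q (q ^ 2) = qshift_inf q (q ^ 4) * qshift_inf (q ^ 3) (q ^ 4)"
    using qshift_inf_dissect[OF norm_power_less_1, of 2 q] by (simp flip: power_mult power_Suc)
  have 4: "qshift_inf (q ^ k) (q ^ 4) = qshift_inf (q ^ k) (q ^ 8) * qshift_inf (q ^ (k + 4)) (q ^ 8)" for k
    using qshift_inf_dissect[OF norm_power_less_1, of 4 "q ^ k"] by (simp flip: power_mult power_add)
  have "even_tail 0 = (qshift_inf q (q ^ 8) * qshift_inf (q ^ 5) (q ^ 8)) * (qshift_inf (q ^ 3) (q ^ 8) * qshift_inf (q ^ 7) (q ^ 8))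
    * neg_odd_tail 0 * (qshift_inf (q ^ 4) (q ^ 8) * qshift_inf (q ^ 8) (q ^ 8))"
    unfolding 2 1 3 using 4[of 1] 4[of 3] 4[of 4] by simp
  moreover have "neg_odd_tail 0 \<noteq> 0"
    unfolding neg_odd_tail_def using q1 by (intro qshift_inf_nonzero norm_mult_power_less_1 norm_power_less_1) auto
  ultimately show ?thesis by (simp add: mult_ac)
qed

lemma qshift_inf_power_nonzero: "k > 0 \<Longrightarrow> qshift_inf (q ^ k) (q ^ 8) \<noteq> 0"
  by (intro qshift_inf_nonzero norm_power_less_1) auto

text \<open>The triple product with p = q^8 and a = q^k. The exponent 4n^2 + 4n - kn is specified by
  an additive equation to avoid subtraction of natural numbers.\<close>

lemma theta_series_sums:
  assumes k: "k > 0" "k < 8" and e: "\<And>n. e n + k * n = 4 * n ^ 2 + 4 * n"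
  shows "(\<lambda>n. neg_odd_tail 0 / even_tail 0 * ((- 1) ^ n * (q ^ e n - q ^ (4 * n ^ 2 + 4 * n + k * n + k))))
    sums (neg_odd_tail 0 / even_tail 0 * (qshift_inf (q ^ 8) (q ^ 8) * qshift_inf (q ^ k) (q ^ 8) * qshift_inf (q ^ (8 - k)) (q ^ 8)))"
proof -
  have "norm (q ^ 8) < norm (q ^ k)"
    using q0 q1 k by (simp add: norm_power power_strict_decreasing)
  hence "(\<lambda>n. (- 1) ^ n * (q ^ 8) ^ (Suc n choose 2) * (1 / (q ^ k) ^ n - (q ^ k) ^ Suc n))
    sums (qshift_inf (q ^ 8) (q ^ 8) * qshift_inf (q ^ k) (q ^ 8) * qshift_inf (q ^ 8 / q ^ k) (q ^ 8))"
    using q0 k by (intro triple_product norm_power_less_1) auto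
  moreover have "q ^ 8 / q ^ k = q ^ (8 - k)"
    using q0 k by (simp add: power_diff)
  moreover have "(- 1) ^ n * (q ^ 8) ^ (Suc n choose 2) * (1 / (q ^ k) ^ n - (q ^ k) ^ Suc n)
    = (- 1) ^ n * (q ^ e n - q ^ (4 * n ^ 2 + 4 * n + k * n + k))" for n
  proof -
    have "8 * (Suc n choose 2) = e n + k * n"
      using choose_two_square[of "Suc n"] unfolding e by (simp add: power2_eq_square algebra_simps)
    hence "(q ^ 8) ^ (Suc n choose 2) = q ^ e n * q ^ (k * n)"
      by (simp only: flip: power_mult power_add)
    moreover have "q ^ (4 * n ^ 2 + 4 * n + k * n + k) = q ^ e n * q ^ (k * n) * q ^ (k * Suc n)"
      unfolding e[symmetric] by (simp add: algebra_simps flip: power_add)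
    ultimately show ?thesis using q0
      by (simp add: right_diff_distrib mult.assoc flip: power_mult del: power_Suc)
  qed
  ultimately show ?thesis by (intro sums_mult) (simp only:)
qed

text \<open>At \<open>m = 0\<close> the polynomial \<open>wp_factor\<close> factors, and its factor
  1 + q^(2n+1) completes \<open>neg_odd_tail (n + 1)\<close> to \<open>neg_odd_tail n\<close>. This
  leaves the theta series with \<open>k = 3\<close>, whose product removes the residues 3, 5 and 8
  from \<open>tail_quotient\<close>.\<close>

lemma wp_sum_0: "wp_sum 0 = 1 / qshifts_inf [q, q ^ 4, q ^ 7] (q ^ 8)"
proof -
  have "wp_term 0 = (\<lambda>n. neg_odd_tail 0 / even_tail 0 * ((- 1) ^ n * (q ^ (4 * n ^ 2 + n) - q ^ (4 * n ^ 2 + 4 * n + 3 * n + 3))))"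
  proof
    fix n
    have "wp_factor 0 n = (1 + q ^ (2 * n + 1)) * (1 - q ^ (6 * n + 3))"
      unfolding wp_factor_def by (simp add: algebra_simps)
    hence "wp_term 0 n = (- 1) ^ n * q ^ (4 * n ^ 2 + n) * (gg_coeff n * neg_odd_tail n / even_tail n) * (1 - q ^ (6 * n + 3))"
      unfolding wp_term_def neg_odd_tail_rec[of n] by simp
    moreover have "q ^ (4 * n ^ 2 + 4 * n + 3 * n + 3) = q ^ (4 * n ^ 2 + n) * q ^ (6 * n + 3)"
      by (simp only: flip: power_add) (simp add: algebra_simps)
    ultimately show "wp_term 0 n = neg_odd_tail 0 / even_tail 0 * ((- 1) ^ n * (q ^ (4 * n ^ 2 + n) - q ^ (4 * n ^ 2 + 4 * n + 3 * n + 3)))"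
      unfolding gg_coeff_tails
      by (simp only: right_diff_distrib left_diff_distrib mult_1_left mult_1_right mult_ac)
  qed
  moreover have "(\<lambda>n. neg_odd_tail 0 / even_tail 0 * ((- 1) ^ n * (q ^ (4 * n ^ 2 + n) - q ^ (4 * n ^ 2 + 4 * n + 3 * n + 3))))
    sums (neg_odd_tail 0 / even_tail 0 * (qshift_inf (q ^ 8) (q ^ 8) * qshift_inf (q ^ 3) (q ^ 8) * qshift_inf (q ^ (8 - 3)) (q ^ 8)))"
    by (rule theta_series_sums) auto
  ultimately have "wp_term 0 sums (neg_odd_tail 0 / even_tail 0 * (qshift_inf (q ^ 8) (q ^ 8) * qshift_inf (q ^ 3) (q ^ 8) * qshift_inf (q ^ (8 - 3)) (q ^ 8)))"
    by (simp only:)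
  hence "wp_sum 0 = neg_odd_tail 0 / even_tail 0 * (qshift_inf (q ^ 8) (q ^ 8) * qshift_inf (q ^ 3) (q ^ 8) * qshift_inf (q ^ 5) (q ^ 8))"
    unfolding wp_sum_def by (simp add: sums_iff)
  thus ?thesis
    unfolding tail_quotient qshifts_inf_def
    using qshift_inf_power_nonzero[of 8] qshift_inf_power_nonzero[of 3] qshift_inf_power_nonzero[of 5]
    by simp
qed

text \<open>The telescoping here undoes the index shift that led to \<open>wp_term\<close>.\<close>

lemma wp_sum_1: "wp_sum 1 = 1 / qshifts_inf [q ^ 3, q ^ 4, q ^ 5] (q ^ 8)"
proof -
  \<comment> \<open>The term of the original very-well-poised series at x = q^2: there 1 - q^(4n+2)
    divided by 1 + q^(2n+1) leaves 1 - q^(2n+1). The form \<open>1 * n + 1\<close> matches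
    \<open>theta_series_sums\<close> with \<open>k = 1\<close>.\<close>
  define s where "s n = neg_odd_tail 0 / even_tail 0 * ((- 1) ^ n * (q ^ (4 * n ^ 2 + 3 * n) - q ^ (4 * n ^ 2 + 4 * n + 1 * n + 1)))" for n
  \<comment> \<open>The part of \<open>s n\<close> that has 1 - q^(2n) in place of 1 - xq^(4n). In
    \<open>wp_term\<close> it was moved from index n + 1 to n, and it vanishes at
    \<open>n = 0\<close>.\<close>
  define Z where "Z n = neg_odd_tail 0 / even_tail 0 * ((- 1) ^ n * q ^ (4 * n ^ 2 + 3 * n)) * (1 - q ^ (2 * n)) / (1 + q ^ (2 * n + 1))" for n
  have s: "s sums (neg_odd_tail 0 / even_tail 0 * (qshift_inf (q ^ 8) (q ^ 8) * qshift_inf (q ^ 1) (q ^ 8) * qshift_inf (q ^ (8 - 1)) (q ^ 8)))"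
    unfolding s_def by (rule theta_series_sums) auto
  have Z_lim: "Z \<longlonglongrightarrow> 0"
  proof -
    have 1: "(\<lambda>n. q ^ (2 * n)) \<longlonglongrightarrow> 0" "(\<lambda>n. q ^ (2 * n + 1)) \<longlonglongrightarrow> 0"
      by (intro power_exponent_tendsto_0; simp)+
    have 2: "(\<lambda>n. (- 1) ^ n * q ^ (4 * n ^ 2 + 3 * n)) \<longlonglongrightarrow> 0"
      using tendsto_norm_zero[OF power_exponent_tendsto_0, of "\<lambda>n. 4 * n ^ 2 + 3 * n"]
      by (intro tendsto_norm_zero_cancel[of "\<lambda>n. (- 1) ^ n * _ n"]) (simp add: norm_mult norm_power)
    have "Z \<longlonglongrightarrow> neg_odd_tail 0 / even_tail 0 * 0 * (1 - 0) / (1 + 0)"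
      unfolding Z_def by (intro tendsto_divide tendsto_mult tendsto_diff tendsto_add tendsto_const 1 2) simp
    thus ?thesis by simp
  qed
  have "wp_term 1 n - s n = Z (Suc n) - Z n" for n
  proof -
    define y where "y = q ^ (2 * n)"
    define w where "w = (- 1) ^ n * q ^ (4 * n ^ 2 + 3 * n)"
    \<comment> \<open>Over the common denominator of \<open>Z n\<close> and
      \<open>Z (Suc n)\<close>, all four terms are \<open>A\<close> times a polynomial in
      \<open>q\<close> and \<open>y\<close>.\<close>
    define A where "A = neg_odd_tail 0 / even_tail 0 * w / ((1 + q * y) * (1 + q ^ 3 * y))"
    have nz: "1 + q * y \<noteq> 0" "1 + q ^ 3 * y \<noteq> 0" "1 - q ^ 2 * y \<noteq> 0"
      using one_plus_power_nonzero[of "2 * n + 1"] one_plus_power_nonzero[of "2 * n + 3"]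
        one_minus_power_nonzero[of "2 * n + 2"]
      by (simp_all add: y_def power_add power2_eq_square mult_ac)
    have y': "q ^ (2 * Suc n) = q ^ 2 * y" "q ^ (2 * n + 1) = q * y" "q ^ (2 * Suc n + 1) = q ^ 3 * y"
      by (simp_all add: y_def eval_nat_numeral)
    have e: "q ^ (4 * (Suc n) ^ 2 + 3 * Suc n) = q ^ (4 * n ^ 2 + 3 * n) * (q ^ 7 * y ^ 4)"
        "q ^ (4 * 1 * n + 4 * n ^ 2 + n) = q ^ (4 * n ^ 2 + 3 * n) * y"
        "q ^ (4 * n ^ 2 + 4 * n + 1 * n + 1) = q ^ (4 * n ^ 2 + 3 * n) * (q * y)"
      unfolding y_def power_mult[symmetric] power_add[symmetric] power_Suc[symmetric]
      by (rule arg_cong[of _ _ "\<lambda>e. q ^ e"]; simp add: algebra_simps power2_eq_square)+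
    have "neg_odd_tail n = (1 + q * y) * (1 + q ^ 3 * y) * neg_odd_tail (n + 2)"
      using neg_odd_tail_rec[of n] neg_odd_tail_rec[of "Suc n"] by (simp add: y_def eval_nat_numeral mult_ac)
    moreover have "even_tail n = (1 - q ^ 2 * y) * even_tail (n + 1)"
      using even_tail_rec[of n] by (simp add: y_def power2_eq_square mult_ac)
    ultimately have cgh: "gg_coeff n * neg_odd_tail (n + 2) / even_tail (n + 1) = neg_odd_tail 0 / even_tail 0 * (1 - q ^ 2 * y) / ((1 + q * y) * (1 + q ^ 3 * y))"
      using nz even_tail_nonzero[of "n + 1"] unfolding gg_coeff_tails[of n, symmetric] by (simp add: mult_ac)
    have wp_factor: "wp_factor 1 n = 1 + q ^ 3 * y - q ^ 7 * y ^ 3 * (1 + q * y)"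
      unfolding wp_factor_def y_def by (simp add: power_add power_mult eval_nat_numeral mult_ac)
    have "wp_term 1 n = w * y * (gg_coeff n * neg_odd_tail (n + 2) / even_tail (n + 1)) * wp_factor 1 n"
      unfolding wp_term_def e w_def by simp
    hence t: "wp_term 1 n = A * (y * (1 - q ^ 2 * y) * (1 + q ^ 3 * y - q ^ 7 * y ^ 3 * (1 + q * y)))"
      unfolding cgh wp_factor A_def by (simp add: mult_ac)
    have s: "s n = A * ((1 - q * y) * (1 + q * y) * (1 + q ^ 3 * y))"
    proof -
      have "s n = neg_odd_tail 0 / even_tail 0 * (w * (1 - q * y))"
        unfolding s_def w_def e by (simp only: right_diff_distrib mult_1_right mult.assoc)
      thus ?thesis unfolding A_def using nz by (simp add: mult_ac)
    qed
    have Z0: "Z n = A * ((1 - y) * (1 + q ^ 3 * y))"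
      unfolding Z_def A_def w_def y' y_def[symmetric] using nz by (simp add: mult_ac)
    have Z1: "Z (Suc n) = A * - (q ^ 7 * y ^ 4 * (1 - q ^ 2 * y) * (1 + q * y))"
      unfolding Z_def A_def w_def y' e using nz by (simp add: mult_ac)
    have "y * (1 - q ^ 2 * y) * (1 + q ^ 3 * y - q ^ 7 * y ^ 3 * (1 + q * y))
        - (1 - q * y) * (1 + q * y) * (1 + q ^ 3 * y)
      = - (q ^ 7 * y ^ 4 * (1 - q ^ 2 * y) * (1 + q * y)) - (1 - y) * (1 + q ^ 3 * y)"
      by algebra
    thus ?thesis
      unfolding t s Z0 Z1 by (simp only: flip: right_diff_distrib)
  qed
  hence "(\<lambda>n. wp_term 1 n - s n) sums (0 - Z 0)"
    using telescope_sums[OF Z_lim] by simp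
  from sums_add[OF this s] have "wp_term 1 sums (neg_odd_tail 0 / even_tail 0 * (qshift_inf (q ^ 8) (q ^ 8) * qshift_inf q (q ^ 8) * qshift_inf (q ^ 7) (q ^ 8)))"
    by (simp add: Z_def)
  hence "wp_sum 1 = neg_odd_tail 0 / even_tail 0 * (qshift_inf (q ^ 8) (q ^ 8) * qshift_inf q (q ^ 8) * qshift_inf (q ^ 7) (q ^ 8))"
    unfolding wp_sum_def by (simp add: sums_iff)
  thus ?thesis
    unfolding tail_quotient qshifts_inf_def
    using qshift_inf_power_nonzero[of 8] qshift_inf_power_nonzero[of 1] qshift_inf_power_nonzero[of 7]
    by simp
qed

section \<open>The right-hand side as a solution of the recurrence\<close>

text \<open>Solving the recurrence of \<open>U\<close> for its term of lowest index divides by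
  q^(2m). The factor q^(m-m^2) absorbs this, its exponent dropping by 2m from m to m + 1, and (-1)^m
  corrects the sign of the middle term.\<close>

lemma explicit_solution_rec:
  fixes U :: "int \<Rightarrow> complex" and R :: "nat \<Rightarrow> complex"
  defines "R \<equiv> \<lambda>m. (- 1) ^ m * q powi (int m - int m ^ 2) * U (int m - 1)"
  assumes U: "U (int m + 1) = (1 + q ^ (2 * m + 1)) * U (int m) + q ^ (2 * m) * U (int m - 1)"
  shows "R m = (1 + q ^ (2 * m + 1)) * R (m + 1) + q ^ (2 * m + 2) * R (m + 2)"
proof -
  define z where "z = q ^ (2 * m)"
  define r where "r = q powi (int m - int m ^ 2)"
  have z: "z \<noteq> 0" using q0 by (simp add: z_def)
  have z_powi: "z = q powi (int (2 * m))"
    unfolding z_def by (rule power_int_of_nat[symmetric])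
  have "q powi (int (m + 1) - int (m + 1) ^ 2) * z = r"
    unfolding z_powi r_def using q0
    by (subst power_int_add[symmetric]) (auto simp: algebra_simps power2_eq_square)
  hence r1: "q powi (int (m + 1) - int (m + 1) ^ 2) = r / z"
    using z by (simp add: field_simps)
  have "q powi (int (m + 2) - int (m + 2) ^ 2) * (z * z * q powi 2) = r"
    unfolding z_powi r_def using q0
    by (subst power_int_add[symmetric], simp)+ (auto simp: algebra_simps power2_eq_square)
  hence r2: "q powi (int (m + 2) - int (m + 2) ^ 2) = r / (z * z * q ^ 2)"
    using z q0 by (simp add: field_simps)
  have R: "R m = (- 1) ^ m * r * U (int m - 1)" "R (m + 1) = - ((- 1) ^ m * (r / z) * U (int m))"
    "R (m + 2) = (- 1) ^ m * (r / (z * z * q ^ 2)) * U (int m + 1)"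
    unfolding R_def r1 r2 r_def by (simp_all add: add_ac)
  have p: "q ^ (2 * m + 1) = q * z" "q ^ (2 * m + 2) = q ^ 2 * z"
    by (simp_all add: z_def power2_eq_square)
  have "q ^ 2 * z * R (m + 2) = (- 1) ^ m * r / z * ((1 + q * z) * U (int m) + z * U (int m - 1))"
    unfolding R U p z_def[symmetric] using z q0 by simp
  thus ?thesis
    unfolding p R(1,2) using z by (simp add: field_simps)
qed

text \<open>Here, in contrast to \<open>recurrence_unique\<close>, the recurrence is run upwards:
  \<open>q ^ (2 * m + 2)\<close> is nonzero, so two initial values determine the rest.\<close>

lemma solution_unique:
  fixes u v :: "nat \<Rightarrow> complex"
  assumes u: "\<And>m. u m = (1 + q ^ (2 * m + 1)) * u (m + 1) + q ^ (2 * m + 2) * u (m + 2)"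
    and v: "\<And>m. v m = (1 + q ^ (2 * m + 1)) * v (m + 1) + q ^ (2 * m + 2) * v (m + 2)"
    and uv: "u 0 = v 0" "u 1 = v 1"
  shows "u m = v m"
proof -
  have "u m = v m \<and> u (m + 1) = v (m + 1)"
  proof (induction m)
    case (Suc m)
    have "q ^ (2 * m + 2) * u (m + 2) = q ^ (2 * m + 2) * v (m + 2)"
      using u[of m] v[of m] Suc by (metis add_left_cancel)
    thus ?case using Suc q0 by simp
  qed (use uv in simp)
  thus ?thesis by simp
qed

end

theorem theorem2p4:
  fixes q :: complex and P Q :: "int \<Rightarrow> complex" and m :: nat
  assumes "0 < norm q" and "norm q < 1"
    and "\<And>k::int. k \<ge> 2 \<Longrightarrow>
           P k = (1 + q powi (2 * k - 1)) * P (k - 1) + q powi (2 * k - 2) * P (k - 2)"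
    and "P (-1) = 0" and "P 0 = 1" and "P 1 = 1 + q"
    and "\<And>k::int. k \<ge> 2 \<Longrightarrow>
           Q k = (1 + q powi (2 * k - 1)) * Q (k - 1) + q powi (2 * k - 2) * Q (k - 2)"
    and "Q (-1) = 1" and "Q 0 = 0" and "Q 1 = 1"
  shows "(\<lambda>n::nat. qshift (- q) (q ^ 2) n * q ^ (n ^ 2 + 2 * m * n) / qshift (q ^ 2) (q ^ 2) n) sums
           ((-1) ^ m * q powi (int m - int m ^ 2) * Q (int m - 1)
              / qshifts_inf [q, q ^ 4, q ^ 7] (q ^ 8)
            - (-1) ^ m * q powi (int m - int m ^ 2) * P (int m - 1)
              / qshifts_inf [q ^ 3, q ^ 4, q ^ 5] (q ^ 8))"
proof -
  have q: "q \<noteq> 0" "norm q < 1" using assms by auto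
  define R where "R U m = (- 1) ^ m * q powi (int m - int m ^ 2) * U (int m - 1)"
    for U :: "int \<Rightarrow> complex" and m
  \<comment> \<open>\<open>U1\<close> is the recurrence at k = 1, which serves the case
    \<open>m = 0\<close>. The recurrences are assumed only from k = 2 on, but the given values of
    \<open>P\<close> and \<open>Q\<close> at -1, 0 and 1 satisfy it.\<close>
  have rec: "R U m = (1 + q ^ (2 * m + 1)) * R U (m + 1) + q ^ (2 * m + 2) * R U (m + 2)"
    if U: "\<And>k::int. k \<ge> 2 \<Longrightarrow>
           U k = (1 + q powi (2 * k - 1)) * U (k - 1) + q powi (2 * k - 2) * U (k - 2)"
      and U1: "U 1 = (1 + q) * U 0 + U (- 1)" for U m
    unfolding R_def
  proof (rule explicit_solution_rec[OF q])
    show "U (int m + 1) = (1 + q ^ (2 * m + 1)) * U (int m) + q ^ (2 * m) * U (int m - 1)"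
    proof (cases "m = 0")
      case False
      have "q powi (2 * (int m + 1) - 1) = q ^ (2 * m + 1)" "q powi (2 * (int m + 1) - 2) = q ^ (2 * m)"
        unfolding power_int_of_nat[symmetric] by (rule arg_cong[of _ _ "\<lambda>e. q powi e"]; simp)+
      thus ?thesis using U[of "int m + 1"] False by simp
    qed (use U1 in simp)
  qed
  define v where "v m = R Q m / qshifts_inf [q, q ^ 4, q ^ 7] (q ^ 8)
    - R P m / qshifts_inf [q ^ 3, q ^ 4, q ^ 5] (q ^ 8)" for m
  have "gg_sum q m = v m"
  proof (rule solution_unique[OF q gg_sum_rec[OF q]])
    fix m
    have "R Q m = (1 + q ^ (2 * m + 1)) * R Q (m + 1) + q ^ (2 * m + 2) * R Q (m + 2)"
      "R P m = (1 + q ^ (2 * m + 1)) * R P (m + 1) + q ^ (2 * m + 2) * R P (m + 2)"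
      using assms by (intro rec; simp)+
    thus "v m = (1 + q ^ (2 * m + 1)) * v (m + 1) + q ^ (2 * m + 2) * v (m + 2)"
      unfolding v_def by (simp only: diff_divide_distrib add_divide_distrib right_diff_distrib
          times_divide_eq_right[symmetric]) (simp only: algebra_simps)
  next
    \<comment> \<open>At index 0 only the first quotient survives; at index 1 only the second, where
      (-1)^1 turns its sign positive.\<close>
    show "gg_sum q 0 = v 0" "gg_sum q 1 = v 1"
      unfolding gg_sum_eq_wp_sum[OF q] wp_sum_0[OF q] wp_sum_1[OF q] v_def R_def using assms by simp_all
  qed
  moreover have "gg_term q m sums gg_sum q m"
    unfolding gg_sum_def[OF q] by (rule summable_sums[OF gg_sum_summable[OF q]])
  ultimately show ?thesis
    unfolding v_def R_def gg_term_def[OF q, abs_def] gg_coeff_def[OF q] by (simp add: mult_ac)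
qed

end
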